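(* Let $\{X_k\}_{k\ge 0}$, $\{\Delta_k\}_{k\ge0}$ be the random iterates and trust region radii generated by the SMOP algorithm described in the context. Assume: (1) each $f_i$, $i=1,\dots,q$, is twice continuously differentiable and bounded from below; (2) there are constants $c_h,c_b>0$ with $\|\nabla^2 f_i(x)\|\le c_h$ for all $x\in\mathbb{R}^n$, $i=1,\dots,q$, and $\beta_k\le c_b$ for every $k$; (3) there are constants $L,c_a>0$ such that, at every iteration $k$, the approximate functions $\tilde F_i$, $i=1,\dots,q$, are continuously differentiable with $L$-Lipschitz continuous gradients and $\|\nabla \tilde F_i(X_k)-G_i(X_k)\|\le c_a\Delta_k$; (4) the sequence of multiple random models $\{\tilde M_{k,1},\dots,\tilde M_{k,q}\}_{k}$ is jointly independent $\alpha$-probabilistically $(c_f,c_g)$ fully linear (JIPFL) with respect to $B(X_k,\Delta_k)$, where $\alpha=\{\alpha_k\}_k$; (5) the sequence $\{X_k\}$ is uniformly bounded; (6) $\sum_{k=0}^\infty(1-\alpha_k^q)\le c_\alpha<\infty$ for some constant $c_\alpha$; (7) with $c_e=c_f+L+c_g+c_a+c_h/2$, the algorithm parameter $\Theta$ and the constant $\nu\in(0,1)$ satisfy $\Theta\ge\max\{c_b,5c_f,4c_e/\eta_1\}$ and $\frac{\nu}{1-\nu}\ge\frac{4\gamma_2^2-2}{\min\{c_e,c_f\}}$. Then almost surely $$\lim_{k\to\infty}\omega(X_k)=0.$$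
   Context: Problem: minimize $f=(f_1,\dots,f_q)^T:\mathbb{R}^n\to\mathbb{R}^q$. $\|\cdot\|$ is the Euclidean (resp. induced matrix) norm; $B(x,\delta)$ is the closed ball. The marginal function is $\omega(x)=-\min_{\|d\|\le1}\max_{i\in\{1,\dots,q\}}\langle\nabla f_i(x),d\rangle$ (it is nonnegative, continuous, and zero at Pareto critical points), and $\phi(x)=\max_{i}f_i(x)$. SMOP algorithm (lowercase: realizations). Input: $x_0\in\mathbb{R}^n$, $\Theta>0$, $\delta_{\max}>0$, $\delta_0\in(0,\delta_{\max})$, $\gamma_1,\eta_1\in(0,1)$, $\gamma_2=1/\gamma_1$. At iteration $k$: approximate functions $\tilde f_i$ (chosen anew at each iteration), vectors $g_i(x_k)\in\mathbb{R}^n$ (approximating $\nabla f_i(x_k)$) and matrices $H^i_k\in\mathbb{R}^{n\times n}$ (approximating Hessians) are chosen randomly, and models are formed: $\tilde m_{k,i}(d)=\tilde f_i(x_k)+\langle g_i(x_k),d\rangle+\frac12\langle d,H^i_kd\rangle$, $\tilde m_k(d)=\max_i\tilde m_{k,i}(d)$. Put $\tilde\phi(x)=\max_i\tilde f_i(x)$, $\omega_m(x_k)=-\min_{\|d\|\le1}\max_i\langle g_i(x_k),d\rangle$, $\beta_k=1+\max_i\|H_k^i\|$. A step $d_k\in B(0,\delta_k)$ is found with $\tilde m_k(0)-\tilde m_k(d_k)\ge\frac12\omega_m(x_k)\min\{\delta_k,\omega_m(x_k)/\beta_k\}$. Let $\rho_k=\frac{\tilde\phi(x_k)-\tilde\phi(x_k+d_k)}{\tilde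 m_k(0)-\tilde m_k(d_k)}$. If $\rho_k\ge\eta_1$ and $\omega_m(x_k)>\Theta\delta_k$ (successful iteration), set $x_{k+1}=x_k+d_k$, $\delta_{k+1}=\min\{\delta_{\max},\gamma_2\delta_k\}$; otherwise set $x_{k+1}=x_k$, $\delta_{k+1}=\gamma_1\delta_k$. Stochastic framework: all randomness, on a probability space $(\Omega,\mathcal F,P)$, comes from the choice of $\tilde f_i,g_i,H^i_k$. The random counterparts of $\tilde f_i,g_i,\tilde m_{k,i},\tilde m_k,x_k,\delta_k$ are $\tilde F_i,G_i,\tilde M_{k,i},\tilde M_k,X_k,\Delta_k$. $X_0=x_0$ is deterministic and $\mathcal F_k$ is the $\sigma$-algebra generated by $X_1,\dots,X_k$ ($\mathcal F_0$ trivial). Fully linear: for fixed $c_f,c_g>0$, a model $m$ is a $(c_f,c_g)$ fully linear model of $h$ on $B(x_k,\delta_k)$ if for all $d\in B(0,\delta_k)$: $|h(x_k+d)-m(d)|\le c_f\delta_k^2$ and $\|\nabla h(x_k+d)-\nabla m(d)\|\le c_g\delta_k$. JIPFL: with $I_{k,i}$ the event that $\tilde M_{k,i}$ is a $(c_f,c_g)$ fully linear model of $f_i$ on $B(X_k,\Delta_k)$, one has $P(I_{k,i}|\mathcal F_k)\ge\alpha_k$ for all $k$ and all $i=1,\dots,q$, and $I_{k,1},\dots,I_{k,q}$ are mutually independent conditionally on $\mathcal F_k$ for all $k$. The constant $\nu$ enters through the Lyapunov function $\Psi_k=\nu\phi(X_k)+(1-\nu)\Delta_k^2$. *)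

theory Defs
  imports "HOL-Probability.Probability"
begin

subsection \<open>Derivatives\<close>

definition grad :: "('a::real_inner \<Rightarrow> real) \<Rightarrow> 'a \<Rightarrow> 'a" where
  "grad h x = (THE g. GDERIV h x :> g)"

definition hessian :: "(real ^ 'n \<Rightarrow> real) \<Rightarrow> real ^ 'n \<Rightarrow> real ^ 'n ^ 'n" where
  "hessian h x = matrix (frechet_derivative (grad h) (at x))"

definition cont_diff :: "(real ^ 'n \<Rightarrow> real) \<Rightarrow> bool" where
  "cont_diff h \<longleftrightarrow> (\<forall>x. h differentiable (at x)) \<and> continuous_on UNIV (grad h)"

definition twice_cont_diff :: "(real ^ 'n \<Rightarrow> real) \<Rightarrow> bool" where
  "twice_cont_diff h \<longleftrightarrow>
     (\<forall>x. h differentiable (at x)) \<and>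
     (\<forall>x. grad h differentiable (at x)) \<and> continuous_on UNIV (hessian h)"

text \<open>The matrix norm induced by the Euclidean norm (\<^const>\<open>norm\<close> on matrices is the
  Frobenius norm).\<close>

definition mat_norm :: "real ^ 'n ^ 'n \<Rightarrow> real" where
  "mat_norm A = onorm (\<lambda>v. A *v v)"

subsection \<open>Marginal function\<close>

text \<open>The index type \<open>'q\<close> plays the role of \<open>{1,\<dots>,q}\<close>, so that \<open>q = CARD('q)\<close>. The infimum
  is of a continuous function over the compact unit ball, hence a minimum.\<close>

definition neg_min_max :: "('q::finite \<Rightarrow> real ^ 'n) \<Rightarrow> real" where
  "neg_min_max v = - (INF d\<in>cball 0 1. MAX i. v i \<bullet> d)"

definition marginal :: "('q::finite \<Rightarrow> real ^ 'n \<Rightarrow> real) \<Rightarrow> real ^ 'n \<Rightarrow> real" where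
  "marginal f x = neg_min_max (\<lambda>i. grad (f i) x)"

subsection \<open>Models\<close>

definition quad_model :: "real \<Rightarrow> real ^ 'n \<Rightarrow> real ^ 'n ^ 'n \<Rightarrow> real ^ 'n \<Rightarrow> real" where
  "quad_model c g H d = c + g \<bullet> d + (1 / 2) * (d \<bullet> (H *v d))"

text \<open>The model \<open>m\<close> takes the displacement \<open>d\<close> from the centre \<open>x\<close> as its argument.\<close>

definition fully_linear ::
  "real \<Rightarrow> real \<Rightarrow> (real ^ 'n \<Rightarrow> real) \<Rightarrow> real ^ 'n \<Rightarrow> real \<Rightarrow> (real ^ 'n \<Rightarrow> real) \<Rightarrow> bool" where
  "fully_linear c\<^sub>f c\<^sub>g h x \<delta> m \<longleftrightarrow>
     (\<forall>d\<in>cball 0 \<delta>. \<bar>h (x + d) - m d\<bar> \<le> c\<^sub>f * \<delta>\<^sup>2 \<and>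
                   norm (grad h (x + d) - grad m d) \<le> c\<^sub>g * \<delta>)"

definition model_beta :: "('q::finite \<Rightarrow> real ^ 'n ^ 'n) \<Rightarrow> real" where
  "model_beta H = 1 + (MAX i. mat_norm (H i))"

subsection \<open>The algorithm\<close>

text \<open>One iteration, from \<open>(x, \<delta>)\<close> to \<open>(x', \<delta>')\<close>, with approximate functions \<open>ft\<close>, gradients
  \<open>g\<close>, Hessians \<open>H\<close> and step \<open>d\<close>. If the predicted reduction vanishes then so does
  \<open>neg_min_max g\<close>, and the iteration is unsuccessful whatever the value of the quotient
  \<open>\<rho>\<close>.\<close>

definition smop_iteration ::
  "real \<Rightarrow> real \<Rightarrow> real \<Rightarrow> real \<Rightarrow> real \<Rightarrow>
   ('q::finite \<Rightarrow> real ^ 'n \<Rightarrow> real) \<Rightarrow> ('q \<Rightarrow> real ^ 'n) \<Rightarrow> ('q \<Rightarrow> real ^ 'n ^ 'n) \<Rightarrow>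
   real ^ 'n \<Rightarrow> real \<Rightarrow> real ^ 'n \<Rightarrow> real ^ 'n \<Rightarrow> real \<Rightarrow> bool" where
  "smop_iteration \<Theta> \<delta>\<^sub>m\<^sub>a\<^sub>x \<gamma>\<^sub>1 \<gamma>\<^sub>2 \<eta>\<^sub>1 ft g H x \<delta> d x' \<delta>' \<longleftrightarrow>
     (let m = (\<lambda>s. MAX i. quad_model (ft i x) (g i) (H i) s);
          \<phi>t = (\<lambda>y. MAX i. ft i y);
          \<omega>\<^sub>m = neg_min_max g;
          \<rho> = (\<phi>t x - \<phi>t (x + d)) / (m 0 - m d)
      in d \<in> cball 0 \<delta> \<and>
         m 0 - m d \<ge> (1 / 2) * \<omega>\<^sub>m * min \<delta> (\<omega>\<^sub>m / model_beta H) \<and>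
         (if \<rho> \<ge> \<eta>\<^sub>1 \<and> \<omega>\<^sub>m > \<Theta> * \<delta>
          then x' = x + d \<and> \<delta>' = min \<delta>\<^sub>m\<^sub>a\<^sub>x (\<gamma>\<^sub>2 * \<delta>)
          else x' = x \<and> \<delta>' = \<gamma>\<^sub>1 * \<delta>))"

text \<open>At iteration \<open>k\<close> and outcome \<open>w\<close>, \<open>Ft k i w\<close> is the \<open>i\<close>-th approximate function,
  \<open>G k i w\<close> the approximate gradient at \<open>X k w\<close>, \<open>H k i w\<close> the approximate Hessian and
  \<open>D k w\<close> the step. The step may be any random vector satisfying the decrease condition.\<close>

definition smop_process ::
  "'w measure \<Rightarrow> real \<Rightarrow> real \<Rightarrow> real \<Rightarrow> real \<Rightarrow> real \<Rightarrow> real ^ 'n \<Rightarrow> real \<Rightarrow>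
   (nat \<Rightarrow> 'q::finite \<Rightarrow> 'w \<Rightarrow> real ^ 'n \<Rightarrow> real) \<Rightarrow> (nat \<Rightarrow> 'q \<Rightarrow> 'w \<Rightarrow> real ^ 'n) \<Rightarrow>
   (nat \<Rightarrow> 'q \<Rightarrow> 'w \<Rightarrow> real ^ 'n ^ 'n) \<Rightarrow>
   (nat \<Rightarrow> 'w \<Rightarrow> real ^ 'n) \<Rightarrow> (nat \<Rightarrow> 'w \<Rightarrow> real ^ 'n) \<Rightarrow> (nat \<Rightarrow> 'w \<Rightarrow> real) \<Rightarrow> bool" where
  "smop_process M \<Theta> \<delta>\<^sub>m\<^sub>a\<^sub>x \<gamma>\<^sub>1 \<gamma>\<^sub>2 \<eta>\<^sub>1 x\<^sub>0 \<delta>\<^sub>0 Ft G H D X \<Delta> \<longleftrightarrow>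
     (\<forall>k i y. (\<lambda>w. Ft k i w y) \<in> borel_measurable M) \<and>
     (\<forall>k i. G k i \<in> borel_measurable M) \<and>
     (\<forall>k i. H k i \<in> borel_measurable M) \<and>
     (\<forall>k. D k \<in> borel_measurable M) \<and>
     (\<forall>k. X k \<in> borel_measurable M) \<and>
     (\<forall>k. \<Delta> k \<in> borel_measurable M) \<and>
     (\<forall>w\<in>space M. X 0 w = x\<^sub>0 \<and> \<Delta> 0 w = \<delta>\<^sub>0 \<and>
        (\<forall>k. smop_iteration \<Theta> \<delta>\<^sub>m\<^sub>a\<^sub>x \<gamma>\<^sub>1 \<gamma>\<^sub>2 \<eta>\<^sub>1
               (\<lambda>i. Ft k i w) (\<lambda>i. G k i w) (\<lambda>i. H k i w)
               (X k w) (\<Delta> k w) (D k w) (X (Suc k) w) (\<Delta> (Suc k) w)))"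

subsection \<open>Probabilistically fully linear models\<close>

text \<open>The \<open>\<sigma>\<close>-algebra generated by \<open>X 1, \<dots>, X k\<close>; it is trivial for \<open>k = 0\<close>.\<close>

definition iter_sigma :: "'w measure \<Rightarrow> (nat \<Rightarrow> 'w \<Rightarrow> 'b::topological_space) \<Rightarrow> nat \<Rightarrow> 'w measure" where
  "iter_sigma M X k =
     sigma (space M) (\<Union>j\<in>{1..k}. {X j -` A \<inter> space M | A. A \<in> sets borel})"

definition cond_prob_given :: "'w measure \<Rightarrow> 'w measure \<Rightarrow> 'w set \<Rightarrow> 'w \<Rightarrow> real" where
  "cond_prob_given M F A = real_cond_exp M F (indicator A)"

definition cond_indep_family :: "'w measure \<Rightarrow> 'w measure \<Rightarrow> ('i \<Rightarrow> 'w set) \<Rightarrow> bool" where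
  "cond_indep_family M F A \<longleftrightarrow>
     (\<forall>J. J \<noteq> {} \<longrightarrow> finite J \<longrightarrow>
        (AE w in M. cond_prob_given M F (\<Inter>j\<in>J. A j) w = (\<Prod>j\<in>J. cond_prob_given M F (A j) w)))"

definition fl_event ::
  "'w measure \<Rightarrow> real \<Rightarrow> real \<Rightarrow> (real ^ 'n \<Rightarrow> real) \<Rightarrow> ('w \<Rightarrow> real ^ 'n) \<Rightarrow> ('w \<Rightarrow> real) \<Rightarrow>
   ('w \<Rightarrow> real ^ 'n \<Rightarrow> real) \<Rightarrow> 'w set" where
  "fl_event M c\<^sub>f c\<^sub>g h X \<Delta> m = {w \<in> space M. fully_linear c\<^sub>f c\<^sub>g h (X w) (\<Delta> w) (m w)}"

definition jipfl ::
  "'w measure \<Rightarrow> real \<Rightarrow> real \<Rightarrow> (nat \<Rightarrow> real) \<Rightarrow> ('q::finite \<Rightarrow> real ^ 'n \<Rightarrow> real) \<Rightarrow>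
   (nat \<Rightarrow> 'w \<Rightarrow> real ^ 'n) \<Rightarrow> (nat \<Rightarrow> 'w \<Rightarrow> real) \<Rightarrow>
   (nat \<Rightarrow> 'q \<Rightarrow> 'w \<Rightarrow> real ^ 'n \<Rightarrow> real) \<Rightarrow> bool" where
  "jipfl M c\<^sub>f c\<^sub>g \<alpha> f X \<Delta> Mt \<longleftrightarrow>
     (\<forall>k. let I = (\<lambda>i. fl_event M c\<^sub>f c\<^sub>g (f i) (X k) (\<Delta> k) (Mt k i)); F = iter_sigma M X k in
        (\<forall>i. I i \<in> sets M) \<and>
        (\<forall>i. AE w in M. cond_prob_given M F (I i) w \<ge> \<alpha> k) \<and>
        cond_indep_family M F I)"

end

theory Submission
  imports Defs
begin

text \<open>Conditional independence gives \<open>P(I\<^sub>k\<^sub>,\<^sub>1 \<inter> \<dots> \<inter> I\<^sub>k\<^sub>,\<^sub>q) \<ge> \<alpha>\<^sub>k ^ q\<close>, so by Borel--Cantelli and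
  the summability of \<open>1 - \<alpha>\<^sub>k ^ q\<close>, almost surely all models are fully linear from some iteration
  on, and the rest of the argument is deterministic. A successful step then decreases \<open>\<phi>\<close> by at
  least \<open>\<omega>\<^sub>m \<delta>\<^sub>k / 10 \<ge> \<Theta> \<delta>\<^sub>k\<^sup>2 / 10\<close>, whence \<open>\<delta>\<^sub>k \<rightarrow> 0\<close>. An iteration with \<open>\<omega>(x\<^sub>k) \<ge> \<kappa> \<delta>\<^sub>k\<close> is
  successful, so \<open>\<omega>(x\<^sub>k)\<close> cannot stay away from \<open>0\<close> (the radius would not shrink). While \<open>\<omega>(x\<^sub>k) \<ge> \<epsilon>\<close>,
  the Lipschitz continuity of \<open>\<omega>\<close> bounds its increase by a multiple of the decrease of
  \<open>\<phi>\<close>; since \<open>\<phi>(x\<^sub>k)\<close> converges, \<open>\<omega>(x\<^sub>k)\<close> cannot climb back.\<close>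

subsection \<open>Gradients\<close>

lemma GDERIV_grad:
  assumes "GDERIV h x :> g"
  shows "grad h x = g"
  unfolding grad_def
proof (rule the_equality[where a = g])
  fix g' assume "GDERIV h x :> g'"
  with assms have "(\<lambda>v. v \<bullet> g') = (\<lambda>v. v \<bullet> g)"
    unfolding gderiv_def by (rule has_derivative_unique[rotated])
  then have "(g' - g) \<bullet> g' = (g' - g) \<bullet> g" by metis
  then have "(g' - g) \<bullet> (g' - g) = 0" by (simp add: inner_diff_right)
  then show "g' = g" by simp
qed fact

text \<open>\<open>grad\<close> is a definite description, so a gradient must first be exhibited:
  the Riesz representative of the derivative, written in the standard basis.\<close>

lemma has_derivative_grad:
  fixes h :: "'a::euclidean_space \<Rightarrow> real"
  assumes "h differentiable (at x)"
  shows "(h has_derivative (\<lambda>v. v \<bullet> grad h x)) (at x)"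
proof -
  obtain h' where h': "(h has_derivative h') (at x)"
    using assms by (auto simp: differentiable_def)
  interpret h': linear h' using h' by (rule has_derivative_linear)
  let ?g = "\<Sum>b\<in>Basis. h' b *\<^sub>R b"
  have "h' v = v \<bullet> ?g" for v
  proof -
    have "h' v = h' (\<Sum>b\<in>Basis. (v \<bullet> b) *\<^sub>R b)" by (simp add: euclidean_representation)
    then show ?thesis
      by (simp add: h'.sum h'.scaleR inner_sum_right mult.commute)
  qed
  then have "h' = (\<lambda>v. v \<bullet> ?g)" by (rule ext)
  then have "GDERIV h x :> ?g" using h' by (simp add: gderiv_def)
  then show ?thesis using GDERIV_grad by (fastforce simp: gderiv_def)
qed

text \<open>Mean value theorem on the segment from \<open>x\<close> to \<open>x + d\<close>. It
  gives \<open>L\<close> where integration would give \<open>L / 2\<close>; the loss only enlarges a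
  threshold later.\<close>

lemma lipschitz_grad_taylor_bound:
  fixes h :: "'a::euclidean_space \<Rightarrow> real"
  assumes diff: "\<And>x. h differentiable (at x)" and lip: "L-lipschitz_on UNIV (grad h)"
  shows "\<bar>h (x + d) - h x - grad h x \<bullet> d\<bar> \<le> L * (norm d)\<^sup>2"
proof -
  have der: "((\<lambda>t. h (x + t *\<^sub>R d)) has_derivative (\<lambda>s. (s *\<^sub>R d) \<bullet> grad h (x + t *\<^sub>R d))) (at t within {0..1})" for t
    by (rule has_derivative_compose[of "\<lambda>t. x + t *\<^sub>R d" "\<lambda>s. s *\<^sub>R d" t "{0..1}" h "\<lambda>v. v \<bullet> grad h (x + t *\<^sub>R d)"])
       (auto intro!: derivative_eq_intros has_derivative_grad diff)
  obtain t :: real where t: "t \<in> {0<..<1}"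
    and "h (x + 1 *\<^sub>R d) - h (x + 0 *\<^sub>R d) = ((1 - 0) *\<^sub>R d) \<bullet> grad h (x + t *\<^sub>R d)"
    using mvt_simple[of 0 1, OF _ der] by (auto simp: greaterThanLessThan_iff)
  then have eq: "h (x + d) - h x = d \<bullet> grad h (x + t *\<^sub>R d)" by simp
  have "dist (grad h (x + t *\<^sub>R d)) (grad h x) \<le> L * dist (x + t *\<^sub>R d) x"
    using lip by (auto dest: lipschitz_onD)
  also have "\<dots> = t * (L * norm d)" using t by (simp add: dist_norm)
  also have "\<dots> \<le> 1 * (L * norm d)"
    using t lipschitz_on_nonneg[OF lip] by (intro mult_right_mono) auto
  finally have nb: "norm (grad h (x + t *\<^sub>R d) - grad h x) \<le> L * norm d" by (simp add: dist_norm)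
  have "h (x + d) - h x - grad h x \<bullet> d = d \<bullet> (grad h (x + t *\<^sub>R d) - grad h x)"
    using eq by (simp add: inner_diff_right inner_commute)
  also have "\<bar>\<dots>\<bar> \<le> norm d * norm (grad h (x + t *\<^sub>R d) - grad h x)"
    by (rule Cauchy_Schwarz_ineq2)
  also have "\<dots> \<le> norm d * (L * norm d)" using nb by (intro mult_left_mono) auto
  finally show ?thesis by (simp add: power2_eq_square ac_simps)
qed

lemma grad_lipschitz_of_hessian_bound:
  assumes "twice_cont_diff h" and bound: "\<And>x. mat_norm (hessian h x) \<le> c"
  shows "norm (grad h x - grad h y) \<le> c * norm (x - y)"
proof (rule differentiable_bound[where S = UNIV and f' = "\<lambda>x. frechet_derivative (grad h) (at x)"])
  fix x :: "real ^ 'a"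
  have d: "(grad h has_derivative frechet_derivative (grad h) (at x)) (at x)"
    using assms(1) by (simp add: twice_cont_diff_def frechet_derivative_works)
  then show "(grad h has_derivative frechet_derivative (grad h) (at x)) (at x within UNIV)" by simp
  have "linear (frechet_derivative (grad h) (at x))" using d by (rule has_derivative_linear)
  \<comment> \<open>The Hessian acts as the derivative of the gradient, so \<open>mat_norm\<close>
    is exactly the operator norm that the mean value inequality asks for.\<close>
  then have "(\<lambda>v. hessian h x *v v) = frechet_derivative (grad h) (at x)"
    by (auto simp: hessian_def matrix_works)
  then show "onorm (frechet_derivative (grad h) (at x)) \<le> c"
    using bound[of x] by (simp add: mat_norm_def)
qed auto

subsection \<open>Quadratic models\<close>

lemma mat_norm_bound: "\<bar>d \<bullet> (A *v d)\<bar> \<le> mat_norm A * (norm d)\<^sup>2"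
proof -
  have "\<bar>d \<bullet> (A *v d)\<bar> \<le> norm d * norm (A *v d)" by (rule Cauchy_Schwarz_ineq2)
  also have "\<dots> \<le> norm d * (mat_norm A * norm d)"
    unfolding mat_norm_def
    by (intro mult_left_mono onorm matrix_vector_mul_bounded_linear) auto
  finally show ?thesis by (simp add: power2_eq_square ac_simps)
qed

lemma quad_model_0 [simp]: "quad_model c g A 0 = c"
  by (simp add: quad_model_def)

text \<open>At the centre the quadratic term has zero derivative, whether or not \<open>A\<close> is
  symmetric. Full linearity at displacement 0 thus compares \<open>g\<close> with the true
  gradient.\<close>

lemma grad_quad_model_0: "grad (quad_model c g A) 0 = g"
proof (rule GDERIV_grad)
  have "((\<lambda>d. c + g \<bullet> d + (1 / 2) * (d \<bullet> (A *v d))) has_derivative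
     (\<lambda>v. g \<bullet> v + (1 / 2) * (0 \<bullet> (A *v v) + v \<bullet> (A *v 0)))) (at 0)"
    by (auto intro!: derivative_eq_intros bounded_linear.has_derivative[OF matrix_vector_mul_bounded_linear])
  then show "GDERIV (quad_model c g A) 0 :> g"
    by (simp add: gderiv_def quad_model_def[abs_def] inner_commute)
qed

lemma mat_norm_nonneg: "0 \<le> mat_norm A"
  unfolding mat_norm_def by (rule onorm_pos_le[OF matrix_vector_mul_bounded_linear])

lemma mat_norm_le_model_beta: "1 + mat_norm (A i) \<le> model_beta A"
  by (simp add: model_beta_def)

lemma model_beta_ge_1: "1 \<le> model_beta A"
  using mat_norm_le_model_beta[of A undefined] mat_norm_nonneg[of "A undefined"] by linarith

subsection \<open>The marginal function\<close>

lemma Max_range_diff_le: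
  fixes u v :: "'i::finite \<Rightarrow> real"
  assumes "\<And>i. \<bar>u i - v i\<bar> \<le> e"
  shows "\<bar>(MAX i. u i) - (MAX i. v i)\<bar> \<le> e"
proof -
  have le: "(MAX i. u i) \<le> (MAX i. v i) + e" if "\<And>i. \<bar>u i - v i\<bar> \<le> e" for u v :: "'i \<Rightarrow> real"
  proof (rule Max.boundedI; clarsimp)
    fix i
    have "v i \<le> (MAX i. v i)" by simp
    then show "u i \<le> (MAX i. v i) + e" using that[of i] by linarith
  qed
  have "(MAX i. u i) \<le> (MAX i. v i) + e" by (rule le) (rule assms)
  moreover have "(MAX i. v i) \<le> (MAX i. u i) + e"
    by (rule le) (subst abs_minus_commute, rule assms)
  ultimately show ?thesis by linarith
qed

text \<open>A real \<open>INF\<close> is informative only over a set that is bounded below.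
  Cauchy-Schwarz for one arbitrary index, here \<open>undefined\<close>, provides the bound.\<close>

lemma bdd_below_Max_inner:
  fixes v :: "'q::finite \<Rightarrow> 'a::real_inner"
  shows "bdd_below ((\<lambda>d. MAX i. v i \<bullet> d) ` cball 0 1)"
proof (rule bdd_belowI2)
  fix d :: 'a assume d: "d \<in> cball 0 1"
  have "- norm (v undefined) \<le> - (norm (v undefined) * norm d)"
    using d by (simp add: mult_left_le)
  also have "\<dots> \<le> v undefined \<bullet> d"
    using Cauchy_Schwarz_ineq2[of "v undefined" d] by linarith
  also have "\<dots> \<le> (MAX i. v i \<bullet> d)" by simp
  finally show "- norm (v undefined) \<le> (MAX i. v i \<bullet> d)" .
qed

lemma neg_min_max_nonneg: "0 \<le> neg_min_max v"
proof -
  have "(INF d\<in>cball 0 1. MAX i. v i \<bullet> d) \<le> (MAX i. v i \<bullet> 0)"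
    by (rule cINF_lower[OF bdd_below_Max_inner]) simp
  then show ?thesis by (simp add: neg_min_max_def)
qed

text \<open>On the unit ball a perturbation by \<open>e\<close> moves each inner product by at most
  \<open>e\<close>, and maximum and infimum preserve this. It serves to compare \<omega> with its
  model version and to show that \<omega> is Lipschitz.\<close>

lemma neg_min_max_diff_le:
  assumes "\<And>i. norm (u i - v i) \<le> e"
  shows "\<bar>neg_min_max u - neg_min_max v\<bar> \<le> e"
proof -
  have le: "neg_min_max u \<le> neg_min_max v + e"
    if uv: "\<And>i. norm (u i - v i) \<le> e" for u v :: "'a \<Rightarrow> real ^ 'b"
  proof -
    have "(INF d\<in>cball 0 1. MAX i. v i \<bullet> d) - e \<le> (MAX i. u i \<bullet> d)" if d: "d \<in> cball 0 1" for d
    proof -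
      have "\<bar>u i \<bullet> d - v i \<bullet> d\<bar> \<le> e" for i
      proof -
        have "\<bar>u i \<bullet> d - v i \<bullet> d\<bar> \<le> norm (u i - v i) * norm d"
          using Cauchy_Schwarz_ineq2[of "u i - v i" d] by (simp add: inner_diff_left)
        also have "\<dots> \<le> norm (u i - v i)" using d by (simp add: mult_left_le)
        finally show ?thesis using uv[of i] by linarith
      qed
      then have "\<bar>(MAX i. u i \<bullet> d) - (MAX i. v i \<bullet> d)\<bar> \<le> e" by (rule Max_range_diff_le)
      moreover have "(INF d\<in>cball 0 1. MAX i. v i \<bullet> d) \<le> (MAX i. v i \<bullet> d)"
        using d by (rule cINF_lower[OF bdd_below_Max_inner])
      ultimately show ?thesis by linarith
    qed
    then have "(INF d\<in>cball 0 1. MAX i. v i \<bullet> d) - e \<le> (INF d\<in>cball 0 1. MAX i. u i \<bullet> d)"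
      by (intro cINF_greatest) auto
    then show ?thesis by (simp add: neg_min_max_def)
  qed
  show ?thesis
    using le[of u v] le[of v u] assms by (simp add: norm_minus_commute abs_le_iff)
qed

subsection \<open>One iteration\<close>

text \<open>Since \<Theta> dominates \<open>model_beta H\<close>, the second test for success makes
  \<delta> the smaller term of the minimum in the decrease condition.\<close>

lemma smop_iteration_predicted_decrease:
  fixes ft :: "'q::finite \<Rightarrow> real ^ 'n \<Rightarrow> real"
  assumes it: "smop_iteration \<Theta> \<delta>\<^sub>m\<^sub>a\<^sub>x \<gamma>\<^sub>1 \<gamma>\<^sub>2 \<eta>\<^sub>1 ft g H x \<delta> d x' \<delta>'"
    and \<delta>: "\<delta> > 0" and beta: "model_beta H \<le> \<Theta>" and large: "neg_min_max g > \<Theta> * \<delta>"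
  shows "(MAX i. quad_model (ft i x) (g i) (H i) 0) - (MAX i. quad_model (ft i x) (g i) (H i) d)
    \<ge> neg_min_max g * \<delta> / 2"
proof -
  have dec: "(MAX i. quad_model (ft i x) (g i) (H i) 0) - (MAX i. quad_model (ft i x) (g i) (H i) d)
      \<ge> (1 / 2) * neg_min_max g * min \<delta> (neg_min_max g / model_beta H)"
    using it by (auto simp: smop_iteration_def Let_def)
  have "\<delta> * model_beta H \<le> \<delta> * \<Theta>" using beta \<delta> by (intro mult_left_mono) auto
  then have "\<delta> \<le> neg_min_max g / model_beta H"
    using large model_beta_ge_1[of H] by (simp add: pos_le_divide_eq mult.commute)
  then show ?thesis using dec by (simp add: min_def)
qed

text \<open>The ratio test concerns the approximate functions, so the decrease of the true maximum
  is drawn from full linearity. Each of the two model errors is at most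
  \<open>c\<^sub>f * \<delta>\<^sup>2\<close>, hence at most a fifth of
  \<open>neg_min_max g * \<delta>\<close>, and 1/2 - 1/5 - 1/5 = 1/10.\<close>

lemma smop_iteration_cases:
  fixes ft :: "'q::finite \<Rightarrow> real ^ 'n \<Rightarrow> real"
  assumes it: "smop_iteration \<Theta> \<delta>\<^sub>m\<^sub>a\<^sub>x \<gamma>\<^sub>1 \<gamma>\<^sub>2 \<eta>\<^sub>1 ft g H x \<delta> d x' \<delta>'"
    and fl: "\<And>i. fully_linear c\<^sub>f c\<^sub>g (f i) x \<delta> (quad_model (ft i x) (g i) (H i))"
    and \<delta>: "\<delta> > 0" and beta: "model_beta H \<le> \<Theta>" and \<Theta>: "\<Theta> \<ge> 5 * c\<^sub>f"
  obtains (unsuccessful) "x' = x" "\<delta>' = \<gamma>\<^sub>1 * \<delta>"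
  | (successful) "norm (x' - x) \<le> \<delta>" "\<delta>' = min \<delta>\<^sub>m\<^sub>a\<^sub>x (\<gamma>\<^sub>2 * \<delta>)" "neg_min_max g > \<Theta> * \<delta>"
      "(MAX i. f i x) - (MAX i. f i x') \<ge> neg_min_max g * \<delta> / 10"
proof -
  define m where "m = (\<lambda>s. MAX i. quad_model (ft i x) (g i) (H i) s)"
  let ?\<omega> = "neg_min_max g"
  have d: "norm d \<le> \<delta>"
    and alt: "(x' = x \<and> \<delta>' = \<gamma>\<^sub>1 * \<delta>) \<or>
      (?\<omega> > \<Theta> * \<delta> \<and> x' = x + d \<and> \<delta>' = min \<delta>\<^sub>m\<^sub>a\<^sub>x (\<gamma>\<^sub>2 * \<delta>))"
    using it by (auto simp: smop_iteration_def Let_def split: if_splits)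
  have phi: "\<bar>(MAX i. f i (x + s)) - m s\<bar> \<le> c\<^sub>f * \<delta>\<^sup>2" if "norm s \<le> \<delta>" for s
    unfolding m_def using fl that by (intro Max_range_diff_le) (auto simp: fully_linear_def)
  have "(MAX i. f i x) - (MAX i. f i (x + d)) \<ge> ?\<omega> * \<delta> / 10" if succ: "?\<omega> > \<Theta> * \<delta>"
  proof -
    have "m 0 - m d \<ge> ?\<omega> * \<delta> / 2"
      unfolding m_def by (rule smop_iteration_predicted_decrease[OF it \<delta> beta succ])
    moreover have "\<bar>(MAX i. f i x) - m 0\<bar> \<le> c\<^sub>f * \<delta>\<^sup>2" using phi[of 0] \<delta> by simp
    moreover note phi[OF d]
    moreover have "5 * c\<^sub>f * \<delta> \<le> ?\<omega>"
      using mult_right_mono[OF \<Theta>, of \<delta>] succ \<delta> by linarith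
    then have "5 * c\<^sub>f * \<delta> * \<delta> \<le> ?\<omega> * \<delta>" using \<delta> by (intro mult_right_mono) auto
    then have "5 * (c\<^sub>f * \<delta>\<^sup>2) \<le> ?\<omega> * \<delta>" by (simp add: power2_eq_square ac_simps)
    ultimately show ?thesis by linarith
  qed
  then show thesis using alt d that by auto
qed

text \<open>The ratio passes once the error of the model against the approximate functions is at
  most \<open>1 - \<eta>\<^sub>1\<close> times the predicted decrease. The error is of order
  \<open>\<delta>\<^sup>2\<close> and the predicted decrease at least
  \<open>neg_min_max g * \<delta> / 2\<close>, which yields the second threshold.\<close>

lemma smop_iteration_successful:
  fixes ft :: "'q::finite \<Rightarrow> real ^ 'n \<Rightarrow> real"
  assumes it: "smop_iteration \<Theta> \<delta>\<^sub>m\<^sub>a\<^sub>x \<gamma>\<^sub>1 \<gamma>\<^sub>2 \<eta>\<^sub>1 ft g H x \<delta> d x' \<delta>'"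
    and \<delta>: "\<delta> > 0" and beta: "model_beta H \<le> \<Theta>" and \<eta>: "\<eta>\<^sub>1 < 1"
    and diff: "\<And>i. cont_diff (ft i)" and lip: "\<And>i. L-lipschitz_on UNIV (grad (ft i))"
    and close: "\<And>i. norm (grad (ft i) x - g i) \<le> c\<^sub>a * \<delta>"
    and large: "neg_min_max g > \<Theta> * \<delta>"
      "neg_min_max g \<ge> 2 * (L + c\<^sub>a + \<Theta>) / (1 - \<eta>\<^sub>1) * \<delta>"
  shows "\<delta>' = min \<delta>\<^sub>m\<^sub>a\<^sub>x (\<gamma>\<^sub>2 * \<delta>)"
proof -
  define m where "m = (\<lambda>s. MAX i. quad_model (ft i x) (g i) (H i) s)"
  let ?\<omega> = "neg_min_max g"
  have d: "norm d \<le> \<delta>"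
    and alt: "((MAX i. ft i x) - (MAX i. ft i (x + d))) / (m 0 - m d) \<ge> \<eta>\<^sub>1 \<and> ?\<omega> > \<Theta> * \<delta> \<Longrightarrow>
      \<delta>' = min \<delta>\<^sub>m\<^sub>a\<^sub>x (\<gamma>\<^sub>2 * \<delta>)"
    using it by (auto simp: smop_iteration_def Let_def m_def split: if_splits)
  \<comment> \<open>The three constants bound the Taylor remainder, the gradient mismatch and the
    Hessian term. At the centre the model is exact.\<close>
  have "\<bar>ft i (x + d) - quad_model (ft i x) (g i) (H i) d\<bar> \<le> (L + c\<^sub>a + \<Theta>) * \<delta>\<^sup>2" for i
  proof -
    have sq: "(norm d)\<^sup>2 \<le> \<delta>\<^sup>2" using d by (simp add: power_mono)
    have "\<bar>ft i (x + d) - ft i x - grad (ft i) x \<bullet> d\<bar> \<le> L * (norm d)\<^sup>2"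
      using diff[of i] by (intro lipschitz_grad_taylor_bound lip) (auto simp: cont_diff_def)
    also have "\<dots> \<le> L * \<delta>\<^sup>2" using sq lipschitz_on_nonneg[OF lip] by (intro mult_left_mono)
    finally have 1: "\<bar>ft i (x + d) - ft i x - grad (ft i) x \<bullet> d\<bar> \<le> L * \<delta>\<^sup>2" .
    have "\<bar>(grad (ft i) x - g i) \<bullet> d\<bar> \<le> norm (grad (ft i) x - g i) * norm d"
      by (rule Cauchy_Schwarz_ineq2)
    also have "\<dots> \<le> (c\<^sub>a * \<delta>) * \<delta>"
      using close[of i] d order_trans[OF norm_ge_zero close] by (intro mult_mono) auto
    finally have 2: "\<bar>grad (ft i) x \<bullet> d - g i \<bullet> d\<bar> \<le> c\<^sub>a * \<delta>\<^sup>2"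
      by (simp add: inner_diff_left power2_eq_square ac_simps)
    have "\<bar>d \<bullet> (H i *v d)\<bar> \<le> mat_norm (H i) * (norm d)\<^sup>2" by (rule mat_norm_bound)
    also have "\<dots> \<le> \<Theta> * \<delta>\<^sup>2"
      using sq mat_norm_le_model_beta[of H i] beta mat_norm_nonneg[of "H i"]
      by (intro mult_mono) auto
    finally have 3: "\<bar>d \<bullet> (H i *v d)\<bar> \<le> \<Theta> * \<delta>\<^sup>2" .
    show ?thesis
      using 1 2 3 unfolding quad_model_def distrib_right by linarith
  qed
  then have "\<bar>(MAX i. ft i (x + d)) - m d\<bar> \<le> (L + c\<^sub>a + \<Theta>) * \<delta>\<^sup>2"
    unfolding m_def by (rule Max_range_diff_le)
  moreover have "(MAX i. ft i x) = m 0" by (simp add: m_def)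
  moreover have pred: "?\<omega> * \<delta> / 2 \<le> m 0 - m d"
    unfolding m_def by (rule smop_iteration_predicted_decrease[OF it \<delta> beta large(1)])
  moreover have "(L + c\<^sub>a + \<Theta>) * \<delta>\<^sup>2 \<le> (1 - \<eta>\<^sub>1) * (m 0 - m d)"
  proof -
    have "2 * (L + c\<^sub>a + \<Theta>) * \<delta> \<le> (1 - \<eta>\<^sub>1) * ?\<omega>"
      using large(2) \<eta> by (simp add: pos_divide_le_eq mult.commute)
    then have "2 * (L + c\<^sub>a + \<Theta>) * \<delta> * \<delta> \<le> (1 - \<eta>\<^sub>1) * ?\<omega> * \<delta>"
      using \<delta> by (intro mult_right_mono) auto
    then have "(L + c\<^sub>a + \<Theta>) * \<delta>\<^sup>2 \<le> (1 - \<eta>\<^sub>1) * (?\<omega> * \<delta> / 2)"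
      by (simp add: power2_eq_square ac_simps)
    also have "\<dots> \<le> (1 - \<eta>\<^sub>1) * (m 0 - m d)" using pred \<eta> by (intro mult_left_mono) auto
    finally show ?thesis .
  qed
  moreover have "(1 - \<eta>\<^sub>1) * (m 0 - m d) = (m 0 - m d) - \<eta>\<^sub>1 * (m 0 - m d)"
    by (simp add: left_diff_distrib)
  ultimately have "(MAX i. ft i x) - (MAX i. ft i (x + d)) \<ge> \<eta>\<^sub>1 * (m 0 - m d)"
    by linarith
  moreover have "0 < \<Theta> * \<delta>" using beta model_beta_ge_1[of H] \<delta> by (intro mult_pos_pos) auto
  then have "0 < ?\<omega> * \<delta>" using large(1) \<delta> by simp
  then have "0 < m 0 - m d" using pred by linarith
  ultimately show ?thesis
    using large(1) by (intro alt) (simp add: pos_le_divide_eq)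
qed

subsection \<open>Convergence of trust-region sequences\<close>

lemma summable_of_telescoping_bound:
  fixes a V :: "nat \<Rightarrow> real"
  assumes a: "\<And>k. 0 \<le> a k" and dec: "\<And>k. a k \<le> V k - V (Suc k)" and bdd: "\<And>k. b \<le> V k"
  shows "summable a"
proof (rule summableI_nonneg_bounded)
  fix n
  have "(\<Sum>k<n. a k) \<le> (\<Sum>k<n. V k - V (Suc k))" by (intro sum_mono dec)
  also have "\<dots> = V 0 - V n" by (rule sum_lessThan_telescope')
  also have "\<dots> \<le> V 0 - b" using bdd by simp
  finally show "(\<Sum>k<n. a k) \<le> V 0 - b" .
qed (rule a)

text \<open>Up to scaling, \<open>V\<close> is the Lyapunov function \<Psi> with \<open>A\<close> in
  place of \<nu> / (1 - \<nu>). Either kind of step lowers it by at least a fixed multiple of the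
  squared radius, so the squared radii are summable.\<close>

lemma trust_region_radius_tendsto_0:
  fixes \<phi> \<delta> :: "nat \<Rightarrow> real"
  assumes c: "c > 0" and \<gamma>\<^sub>1: "0 < \<gamma>\<^sub>1" "\<gamma>\<^sub>1 < 1" and \<delta>: "\<And>k. \<delta> k \<ge> 0" and bdd: "\<And>k. b \<le> \<phi> k"
    and step: "\<And>k. (\<phi> (Suc k) = \<phi> k \<and> \<delta> (Suc k) = \<gamma>\<^sub>1 * \<delta> k) \<or>
      (c * (\<delta> k)\<^sup>2 \<le> \<phi> k - \<phi> (Suc k) \<and> \<delta> (Suc k) \<le> \<gamma>\<^sub>2 * \<delta> k)"
  shows "\<delta> \<longlonglongrightarrow> 0"
proof -
  define A where "A = \<gamma>\<^sub>2\<^sup>2 / c"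
  have A: "A \<ge> 0" using c by (simp add: A_def)
  \<comment> \<open>\<open>A\<close> is such that on a successful step the decrease of \<open>A * \<phi>\<close> outweighs the growth of
    \<open>\<delta>\<^sup>2\<close> to at most \<open>\<gamma>\<^sub>2\<^sup>2 * \<delta>\<^sup>2\<close>.\<close>
  define V where "V = (\<lambda>k. A * \<phi> k + (\<delta> k)\<^sup>2)"
  have "(1 - \<gamma>\<^sub>1\<^sup>2) * (\<delta> k)\<^sup>2 \<le> V k - V (Suc k)" for k
    using step[of k]
  proof
    assume *: "c * (\<delta> k)\<^sup>2 \<le> \<phi> k - \<phi> (Suc k) \<and> \<delta> (Suc k) \<le> \<gamma>\<^sub>2 * \<delta> k"
    have "(\<delta> (Suc k))\<^sup>2 \<le> (\<gamma>\<^sub>2 * \<delta> k)\<^sup>2" using * \<delta> by (intro power_mono) auto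
    also have "\<dots> = A * (c * (\<delta> k)\<^sup>2)" using c by (simp add: A_def power_mult_distrib)
    also have "\<dots> \<le> A * (\<phi> k - \<phi> (Suc k))" using * A by (intro mult_left_mono) auto
    finally have "(\<delta> k)\<^sup>2 \<le> V k - V (Suc k)" by (simp add: V_def algebra_simps)
    moreover have "(1 - \<gamma>\<^sub>1\<^sup>2) * (\<delta> k)\<^sup>2 \<le> (\<delta> k)\<^sup>2" by (simp add: left_diff_distrib)
    ultimately show ?thesis by linarith
  qed (simp add: V_def algebra_simps)
  moreover have \<gamma>: "\<gamma>\<^sub>1\<^sup>2 < 1" using \<gamma>\<^sub>1 by (simp add: power_less_one_iff)
  moreover have "A * b \<le> V k" for k
    using mult_left_mono[OF bdd[of k] A] by (simp add: V_def add_increasing2)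
  ultimately have "summable (\<lambda>k. (1 - \<gamma>\<^sub>1\<^sup>2) * (\<delta> k)\<^sup>2)"
    by (intro summable_of_telescoping_bound[where V = V and b = "A * b"]) auto
  then have "summable (\<lambda>k. (\<delta> k)\<^sup>2)" using \<gamma> by (simp add: summable_cmult_iff)
  then have "(\<lambda>k. sqrt ((\<delta> k)\<^sup>2)) \<longlonglongrightarrow> sqrt 0" by (intro tendsto_real_sqrt summable_LIMSEQ_zero)
  then show ?thesis using \<delta> by simp
qed

lemma trust_region_criticality_tendsto_0:
  fixes \<phi> \<delta> \<omega> :: "nat \<Rightarrow> real"
  assumes pos: "\<delta>\<^sub>m\<^sub>a\<^sub>x > 0" "\<gamma>\<^sub>2 \<ge> 1" "c > 0" "\<kappa> > 0" and \<delta>: "\<And>k. \<delta> k > 0" "\<delta> \<longlonglongrightarrow> 0"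
    and bdd: "\<And>k. b \<le> \<phi> k" and \<omega>: "\<And>k. \<omega> k \<ge> 0"
    and iter: "\<And>k. (\<phi> (Suc k) = \<phi> k \<and> \<omega> (Suc k) = \<omega> k) \<or>
      (c * (\<omega> k - \<kappa> * \<delta> k) * \<delta> k \<le> \<phi> k - \<phi> (Suc k) \<and> \<bar>\<omega> (Suc k) - \<omega> k\<bar> \<le> \<kappa> * \<delta> k)"
    and dec: "\<And>k. \<phi> (Suc k) \<le> \<phi> k"
    and succ: "\<And>k. \<omega> k \<ge> \<kappa> * \<delta> k \<Longrightarrow> \<delta> (Suc k) = min \<delta>\<^sub>m\<^sub>a\<^sub>x (\<gamma>\<^sub>2 * \<delta> k)"
  shows "\<omega> \<longlonglongrightarrow> 0"
proof (rule LIMSEQ_I)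
  fix r :: real assume r: "r > 0"
  define e where "e = r / 4"
  have e: "e > 0" using r by (simp add: e_def)
  \<comment> \<open>While \<omega> is at least \<open>e\<close> and
    \<open>\<kappa> * \<delta> k\<close> is below \<open>e / 2\<close>, a successful step lowers
    \<phi> by at least \<open>c * (e / 2) * \<delta> k\<close> and raises \<omega> by at most
    \<open>\<kappa> * \<delta> k\<close>; \<open>C\<close> is the quotient of these.\<close>
  define C where "C = 2 * \<kappa> / (c * e)"
  have C: "C > 0" using pos e by (simp add: C_def)
  have "decseq \<phi>" using dec by (simp add: decseq_Suc_iff)
  then obtain l where l: "\<phi> \<longlonglongrightarrow> l" "\<And>k. l \<le> \<phi> k"
    using decseq_convergent[of \<phi> b] bdd by metis
  \<comment> \<open>Beyond \<open>K\<close> the radius is below its cap, one step changes \<omega>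
    by less than \<open>e / 2\<close>, and \<open>C\<close> times all decrease of \<phi> still to
    come is at most \<open>e\<close>.\<close>
  have "\<forall>\<^sub>F k in sequentially. \<delta> k < min \<delta>\<^sub>m\<^sub>a\<^sub>x (e / (2 * \<kappa>)) \<and> \<phi> k < l + e / C"
    using pos e C by (intro eventually_conj order_tendstoD(2)[OF \<delta>(2)] order_tendstoD(2)[OF l(1)]) auto
  then obtain K where K: "\<And>k. k \<ge> K \<Longrightarrow> \<delta> k < \<delta>\<^sub>m\<^sub>a\<^sub>x" "\<And>k. k \<ge> K \<Longrightarrow> \<kappa> * \<delta> k < e / 2"
    "\<And>k. k \<ge> K \<Longrightarrow> \<phi> k < l + e / C"
    using pos(4) by (auto simp: eventually_sequentially pos_less_divide_eq mult_ac)
  have "\<exists>k\<ge>K. \<omega> k < e"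
  proof (rule ccontr)
    assume "\<not> (\<exists>k\<ge>K. \<omega> k < e)"
    then have big: "\<omega> k \<ge> e" if "k \<ge> K" for k using that by (meson not_less)
    \<comment> \<open>If \<omega> stays above \<open>e\<close>, every step is successful. Even when
      the cap is active the new radius is at least \<open>\<delta> K\<close>, because
      \<open>\<delta> K\<close> lies below the cap.\<close>
    have "\<delta> K \<le> \<delta> k" if "k \<ge> K" for k
      using that
    proof (induction k rule: dec_induct)
      case (step k)
      have "\<delta> (Suc k) = min \<delta>\<^sub>m\<^sub>a\<^sub>x (\<gamma>\<^sub>2 * \<delta> k)"
        using big K(2)[of k] step e by (intro succ) force
      moreover have "\<delta> k \<le> \<gamma>\<^sub>2 * \<delta> k" using pos \<delta>(1)[of k] by simp
      ultimately show ?case using step K(1)[of K] by auto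
    qed simp
    then have "\<delta> K \<le> 0" using \<delta>(2) by (intro LIMSEQ_le_const) auto
    then show False using \<delta>(1)[of K] by linarith
  qed
  then obtain k\<^sub>1 where k\<^sub>1: "k\<^sub>1 \<ge> K" "\<omega> k\<^sub>1 < e" by blast
  \<comment> \<open>The invariant survives an iterate with \<open>\<omega> k < e\<close> because steps are short, and one with
    \<open>\<omega> k \<ge> e\<close> because \<open>C\<close> times the decrease of \<open>\<phi>\<close> pays for the increase of \<open>\<omega>\<close>.\<close>
  have bound: "\<omega> k \<le> 2 * e + C * (\<phi> k\<^sub>1 - \<phi> k)" if "k \<ge> k\<^sub>1" for k
    using that
  proof (induction k rule: dec_induct)
    case base
    then show ?case using k\<^sub>1 e by simp
  next
    case (step k)
    have mono: "C * (\<phi> k\<^sub>1 - \<phi> k) \<le> C * (\<phi> k\<^sub>1 - \<phi> (Suc k))"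
      using C dec[of k] by (intro mult_left_mono) auto
    have small: "\<kappa> * \<delta> k < e / 2" using K(2) step k\<^sub>1 by simp
    from iter[of k] show ?case
    proof
      assume "\<phi> (Suc k) = \<phi> k \<and> \<omega> (Suc k) = \<omega> k"
      then show ?thesis using step by simp
    next
      assume *: "c * (\<omega> k - \<kappa> * \<delta> k) * \<delta> k \<le> \<phi> k - \<phi> (Suc k) \<and> \<bar>\<omega> (Suc k) - \<omega> k\<bar> \<le> \<kappa> * \<delta> k"
      show ?thesis
      proof (cases "\<omega> k < e")
        case True
        have "0 \<le> C * (\<phi> k\<^sub>1 - \<phi> (Suc k))"
          using C decseqD[OF \<open>decseq \<phi>\<close>, of k\<^sub>1 "Suc k"] step by (intro mult_nonneg_nonneg) auto
        then show ?thesis using True * small e by linarith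
      next
        case False
        have "c * (e / 2) * \<delta> k \<le> c * (\<omega> k - \<kappa> * \<delta> k) * \<delta> k"
          using False small pos \<delta>(1)[of k] by (intro mult_right_mono mult_left_mono) auto
        then have "C * (c * (e / 2) * \<delta> k) \<le> C * (\<phi> k - \<phi> (Suc k))"
          using * C by (intro mult_left_mono) auto
        moreover have "C * (c * (e / 2) * \<delta> k) = \<kappa> * \<delta> k"
          using pos e by (simp add: C_def)
        moreover have "C * (\<phi> k\<^sub>1 - \<phi> (Suc k)) = C * (\<phi> k\<^sub>1 - \<phi> k) + C * (\<phi> k - \<phi> (Suc k))"
          by (simp add: algebra_simps)
        ultimately show ?thesis using * step.IH by linarith
      qed
    qed
  qed
  have "norm (\<omega> k - 0) < r" if k: "k \<ge> k\<^sub>1" for k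
  proof -
    \<comment> \<open>Both values of \<phi> lie between \<open>l\<close> and
      \<open>l + e / C\<close>, so the invariant gives \<omega> at most \<open>3 * e\<close>, which
      is less than \<open>r\<close>.\<close>
    have "C * (\<phi> k\<^sub>1 - \<phi> k) \<le> C * (e / C)"
      using K(3)[OF k\<^sub>1(1)] l(2)[of k] C by (intro mult_left_mono) auto
    then show ?thesis using bound[OF k] \<omega>[of k] C e by (simp add: e_def)
  qed
  then show "\<exists>no. \<forall>n\<ge>no. norm (\<omega> n - 0) < r" by blast
qed

subsection \<open>Almost all models are fully linear\<close>

lemma subalgebra_iter_sigma:
  assumes "\<And>j. X j \<in> borel_measurable M"
  shows "subalgebra M (iter_sigma M X k)"
proof -
  let ?E = "\<Union>j\<in>{1..k}. {X j -` A \<inter> space M | A. A \<in> sets borel}"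
  have "?E \<subseteq> sets M" using assms by (auto intro: measurable_sets)
  then have "sigma_sets (space M) ?E \<subseteq> sets M" by (rule sets.sigma_sets_subset)
  moreover have "?E \<subseteq> Pow (space M)" by auto
  ultimately show ?thesis by (simp add: subalgebra_def iter_sigma_def)
qed

text \<open>The product bound holds almost surely for the conditional probability of the
  intersection; integrating removes the conditioning.\<close>

lemma (in prob_space) prob_Inter_ge_of_cond_indep_family:
  fixes A :: "'i::finite \<Rightarrow> 'a set"
  assumes sub: "subalgebra M F" and A: "\<And>i. A i \<in> events"
    and lower: "\<And>i. AE w in M. cond_prob_given M F (A i) w \<ge> a" and "a \<ge> 0"
    and indep: "cond_indep_family M F A"
  shows "prob (\<Inter>i. A i) \<ge> a ^ CARD('i)"
proof -
  interpret finite_measure_subalgebra M F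
    using sub by unfold_locales
  have int: "integrable M (indicator (\<Inter>i. A i) :: 'a \<Rightarrow> real)"
    using A by (intro integrable_real_indicator) (auto simp: emeasure_eq_measure)
  have "AE w in M. cond_prob_given M F (\<Inter>i. A i) w = (\<Prod>i\<in>UNIV. cond_prob_given M F (A i) w)"
    using indep by (auto simp: cond_indep_family_def)
  moreover have "AE w in M. \<forall>i. cond_prob_given M F (A i) w \<ge> a"
    using lower by (subst AE_all_countable) auto
  ultimately have ae: "AE w in M. a ^ CARD('i) \<le> cond_prob_given M F (\<Inter>i. A i) w"
  proof eventually_elim
    case (elim w)
    have "(\<Prod>i::'i\<in>UNIV. a) \<le> (\<Prod>i\<in>UNIV. cond_prob_given M F (A i) w)"
      using elim \<open>a \<ge> 0\<close> by (intro prod_mono) auto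
    then show ?case using elim by simp
  qed
  have "a ^ CARD('i) = (\<integral>w. a ^ CARD('i) \<partial>M)" by (simp add: prob_space)
  also have "\<dots> \<le> (\<integral>w. cond_prob_given M F (\<Inter>i. A i) w \<partial>M)"
    using ae real_cond_exp_int(1)[OF int]
    by (intro integral_mono_AE) (auto simp: cond_prob_given_def)
  also have "\<dots> = prob (\<Inter>i. A i)"
    using real_cond_exp_int(2)[OF int] A by (simp add: cond_prob_given_def)
  finally show ?thesis .
qed

text \<open>The first Borel-Cantelli lemma asks only for summable probabilities of the bad events,
  so dependence between iterations is harmless.\<close>

lemma (in prob_space) jipfl_AE_eventually_fully_linear:
  fixes f :: "'q::finite \<Rightarrow> real ^ 'n \<Rightarrow> real"
  assumes X: "\<And>k. X k \<in> borel_measurable M" and \<alpha>: "\<And>k. \<alpha> k \<ge> 0"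
    and jipfl: "jipfl M c\<^sub>f c\<^sub>g \<alpha> f X \<Delta> Mt" and summ: "summable (\<lambda>k. 1 - \<alpha> k ^ CARD('q))"
  shows "AE w in M. \<forall>\<^sub>F k in sequentially. \<forall>i. fully_linear c\<^sub>f c\<^sub>g (f i) (X k w) (\<Delta> k w) (Mt k i w)"
proof -
  define I where "I = (\<lambda>k i. fl_event M c\<^sub>f c\<^sub>g (f i) (X k) (\<Delta> k) (Mt k i))"
  have J: "I k i \<in> events" "AE w in M. cond_prob_given M (iter_sigma M X k) (I k i) w \<ge> \<alpha> k"
    "cond_indep_family M (iter_sigma M X k) (I k)" for k i
    using jipfl by (auto simp: jipfl_def Let_def I_def)
  let ?B = "\<lambda>k. space M - (\<Inter>i. I k i)"
  have B: "?B k \<in> events" for k using J(1) by auto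
  have "prob (?B k) \<le> 1 - \<alpha> k ^ CARD('q)" for k
    using prob_Inter_ge_of_cond_indep_family[OF subalgebra_iter_sigma[of X M k, OF X] J(1) J(2) \<alpha> J(3)] J(1)
    by (subst prob_compl) auto
  then have "summable (\<lambda>k. prob (?B k))"
    by (intro summable_comparison_test'[OF summ]) auto
  then have "AE w in M. \<forall>\<^sub>F k in sequentially. w \<in> space M - ?B k"
    using B by (intro borel_cantelli_AE1) (auto simp: emeasure_eq_measure)
  then show ?thesis
    by eventually_elim (auto simp: I_def fl_event_def elim: eventually_mono)
qed



subsection \<open>Convergence of the algorithm\<close>

text \<open>A statement about one realization whose models are all fully linear. It is meant for the
  tail of a path, hence the starting radius is only required to be positive.\<close>

lemma smop_path_marginal_tendsto_0:
  fixes f :: "'q::finite \<Rightarrow> real ^ 'n \<Rightarrow> real" and x :: "nat \<Rightarrow> real ^ 'n"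
  assumes it: "\<And>k. smop_iteration \<Theta> \<delta>\<^sub>m\<^sub>a\<^sub>x \<gamma>\<^sub>1 \<gamma>\<^sub>2 \<eta>\<^sub>1 (ft k) (g k) (H k) (x k) (\<delta> k) (d k)
      (x (Suc k)) (\<delta> (Suc k))"
    and fl: "\<And>k i. fully_linear c\<^sub>f c\<^sub>g (f i) (x k) (\<delta> k)
      (quad_model (ft k i (x k)) (g k i) (H k i))"
    and params: "\<delta>\<^sub>m\<^sub>a\<^sub>x > 0" "0 < \<gamma>\<^sub>1" "\<gamma>\<^sub>1 < 1" "\<gamma>\<^sub>2 \<ge> 1" "\<eta>\<^sub>1 < 1" "c\<^sub>g \<ge> 0" "c\<^sub>h \<ge> 0" "c\<^sub>a \<ge> 0"
    and \<Theta>: "\<Theta> \<ge> 5 * c\<^sub>f" and beta: "\<And>k. model_beta (H k) \<le> \<Theta>"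
    and \<delta>0: "\<delta> 0 > 0"
    and f: "\<And>i. twice_cont_diff (f i)" "\<And>i. bdd_below (range (f i))"
      "\<And>i y. mat_norm (hessian (f i) y) \<le> c\<^sub>h"
    and ft: "\<And>k i. cont_diff (ft k i)" "\<And>k i. L-lipschitz_on UNIV (grad (ft k i))"
      "\<And>k i. norm (grad (ft k i) (x k) - g k i) \<le> c\<^sub>a * \<delta> k"
  shows "(\<lambda>k. marginal f (x k)) \<longlonglongrightarrow> 0"
proof -
  define \<phi> where "\<phi> = (\<lambda>k. MAX i. f i (x k))"
  define C where "C = 2 * (L + c\<^sub>a + \<Theta>) / (1 - \<eta>\<^sub>1)"
  \<comment> \<open>One constant for several purposes: \<open>c\<^sub>g\<close> pays for passing
    from \<omega> to its model version, \<open>c\<^sub>h\<close> is the Lipschitz constant of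
    \<omega>, \<Theta> and \<open>C\<close> are the two thresholds for success, and 1 makes the
    first of these strict.\<close>
  define \<kappa> where "\<kappa> = c\<^sub>g + c\<^sub>h + \<Theta> + C + 1"
  have \<Theta>pos: "\<Theta> > 0" using beta[of 0] model_beta_ge_1[of "H 0"] by linarith
  have C: "C \<ge> 0"
    using params lipschitz_on_nonneg[OF ft(2)] \<Theta>pos by (simp add: C_def)
  have cases: "(x (Suc k) = x k \<and> \<delta> (Suc k) = \<gamma>\<^sub>1 * \<delta> k) \<or>
      (norm (x (Suc k) - x k) \<le> \<delta> k \<and> \<delta> (Suc k) = min \<delta>\<^sub>m\<^sub>a\<^sub>x (\<gamma>\<^sub>2 * \<delta> k) \<and>
       neg_min_max (g k) > \<Theta> * \<delta> k \<and> \<phi> k - \<phi> (Suc k) \<ge> neg_min_max (g k) * \<delta> k / 10)"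
    if "\<delta> k > 0" for k
    using smop_iteration_cases[OF it fl that beta \<Theta>] unfolding \<phi>_def by metis
  have \<delta>: "\<delta> k > 0" for k
  proof (induction k)
    case (Suc k)
    then show ?case using cases[OF Suc] params by auto
  qed (rule \<delta>0)
  obtain b where "\<And>y. b \<le> f undefined y" using f(2) by (auto simp: bdd_below_def)
  moreover have "f undefined (x k) \<le> \<phi> k" for k by (simp add: \<phi>_def)
  ultimately have bdd: "b \<le> \<phi> k" for k by (meson order_trans)
  have grad_model: "norm (grad (f i) (x k) - g k i) \<le> c\<^sub>g * \<delta> k" for i k
  proof -
    have "0 \<in> cball 0 (\<delta> k)" using \<delta>[of k] by simp
    then show ?thesis
      using fl[where k = k and i = i] unfolding fully_linear_def by (metis add.right_neutral grad_quad_model_0)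
  qed
  then have crit: "\<bar>marginal f (x k) - neg_min_max (g k)\<bar> \<le> c\<^sub>g * \<delta> k" for k
    unfolding marginal_def by (intro neg_min_max_diff_le)
  have lip: "\<bar>marginal f y - marginal f z\<bar> \<le> c\<^sub>h * norm (y - z)" for y z
    unfolding marginal_def by (intro neg_min_max_diff_le grad_lipschitz_of_hessian_bound f)
  have \<kappa>: "c\<^sub>g * \<delta> k \<le> \<kappa> * \<delta> k" "c\<^sub>h * \<delta> k \<le> \<kappa> * \<delta> k" for k
    using \<delta>[of k] params \<Theta>pos C by (auto simp: \<kappa>_def intro!: mult_right_mono)
  have dec: "\<phi> (Suc k) \<le> \<phi> k" for k
  proof -
    have "0 \<le> neg_min_max (g k) * \<delta> k / 10" using \<delta>[of k] neg_min_max_nonneg[of "g k"] by simp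
    moreover have "\<phi> (Suc k) = \<phi> k" if "x (Suc k) = x k" using that by (simp add: \<phi>_def)
    ultimately show ?thesis using cases[OF \<delta>, of k] by linarith
  qed
  have "\<delta> \<longlonglongrightarrow> 0"
  proof (rule trust_region_radius_tendsto_0[where \<phi> = \<phi> and c = "\<Theta> / 10"])
    fix k
    have "\<Theta> / 10 * (\<delta> k)\<^sup>2 \<le> neg_min_max (g k) * \<delta> k / 10" if "neg_min_max (g k) > \<Theta> * \<delta> k"
      using mult_right_mono[of "\<Theta> * \<delta> k" "neg_min_max (g k)" "\<delta> k"] that \<delta>[of k]
      by (simp add: power2_eq_square mult.assoc)
    then show "(\<phi> (Suc k) = \<phi> k \<and> \<delta> (Suc k) = \<gamma>\<^sub>1 * \<delta> k) \<or>
        (\<Theta> / 10 * (\<delta> k)\<^sup>2 \<le> \<phi> k - \<phi> (Suc k) \<and> \<delta> (Suc k) \<le> \<gamma>\<^sub>2 * \<delta> k)"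
      using cases[OF \<delta>, of k] by (auto simp: \<phi>_def)
  qed (use \<Theta>pos params \<delta> bdd in \<open>auto intro: less_imp_le\<close>)
  then show ?thesis
  proof (rule trust_region_criticality_tendsto_0[where \<phi> = \<phi> and \<delta> = \<delta> and c = "1 / 10" and \<kappa> = \<kappa>, rotated 5])
    fix k
    show "(\<phi> (Suc k) = \<phi> k \<and> marginal f (x (Suc k)) = marginal f (x k)) \<or>
      (1 / 10 * (marginal f (x k) - \<kappa> * \<delta> k) * \<delta> k \<le> \<phi> k - \<phi> (Suc k) \<and>
       \<bar>marginal f (x (Suc k)) - marginal f (x k)\<bar> \<le> \<kappa> * \<delta> k)"
      using cases[OF \<delta>, of k]
    proof (elim disjE conjE)
      assume *: "norm (x (Suc k) - x k) \<le> \<delta> k" "\<phi> k - \<phi> (Suc k) \<ge> neg_min_max (g k) * \<delta> k / 10"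
      \<comment> \<open>The decrease is known in terms of the model criticality; \<open>crit\<close>
        rewrites it in terms of \<omega> at the cost of
        \<open>\<kappa> * \<delta> k\<close>.\<close>
      have "marginal f (x k) - \<kappa> * \<delta> k \<le> neg_min_max (g k)" using crit[of k] \<kappa>(1)[of k] by linarith
      then have "(marginal f (x k) - \<kappa> * \<delta> k) * \<delta> k \<le> neg_min_max (g k) * \<delta> k"
        using \<delta>[of k] by (intro mult_right_mono) auto
      moreover have "c\<^sub>h * norm (x (Suc k) - x k) \<le> c\<^sub>h * \<delta> k"
        using *(1) params by (intro mult_left_mono)
      ultimately show ?thesis using *(2) lip[of "x (Suc k)" "x k"] \<kappa>(2)[of k] by simp
    qed (simp add: \<phi>_def)
    show "\<delta> (Suc k) = min \<delta>\<^sub>m\<^sub>a\<^sub>x (\<gamma>\<^sub>2 * \<delta> k)" if large: "marginal f (x k) \<ge> \<kappa> * \<delta> k"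
    proof (rule smop_iteration_successful[OF it \<delta> beta _ ft])
      have "\<kappa> * \<delta> k = c\<^sub>g * \<delta> k + c\<^sub>h * \<delta> k + (\<Theta> + C + 1) * \<delta> k"
        by (simp add: \<kappa>_def algebra_simps)
      moreover have "0 \<le> c\<^sub>h * \<delta> k" using params \<delta>[of k] by simp
      ultimately have "(\<Theta> + C + 1) * \<delta> k \<le> neg_min_max (g k)"
        using large crit[of k] by linarith
      moreover have "\<Theta> * \<delta> k < (\<Theta> + C + 1) * \<delta> k" "C * \<delta> k \<le> (\<Theta> + C + 1) * \<delta> k"
        using \<delta>[of k] C \<Theta>pos by (auto intro!: mult_strict_right_mono mult_right_mono)
      ultimately show "neg_min_max (g k) > \<Theta> * \<delta> k"
        "neg_min_max (g k) \<ge> 2 * (L + c\<^sub>a + \<Theta>) / (1 - \<eta>\<^sub>1) * \<delta> k"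
        by (simp_all add: C_def)
    qed (rule params)
    show "0 \<le> marginal f (x k)" by (simp add: marginal_def neg_min_max_nonneg)
  qed (use params C \<Theta>pos \<delta> bdd dec in \<open>auto simp: \<kappa>_def\<close>)
qed

theorem theorem6:
  fixes M :: "'w measure"
    and f :: "'q::finite \<Rightarrow> real ^ 'n \<Rightarrow> real"
    and Ft :: "nat \<Rightarrow> 'q \<Rightarrow> 'w \<Rightarrow> real ^ 'n \<Rightarrow> real"
    and G :: "nat \<Rightarrow> 'q \<Rightarrow> 'w \<Rightarrow> real ^ 'n"
    and H :: "nat \<Rightarrow> 'q \<Rightarrow> 'w \<Rightarrow> real ^ 'n ^ 'n"
    and D X :: "nat \<Rightarrow> 'w \<Rightarrow> real ^ 'n"
    and \<Delta> :: "nat \<Rightarrow> 'w \<Rightarrow> real"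
    and x\<^sub>0 :: "real ^ 'n"
    and \<alpha> :: "nat \<Rightarrow> real"
    and \<Theta> \<delta>\<^sub>m\<^sub>a\<^sub>x \<delta>\<^sub>0 \<gamma>\<^sub>1 \<gamma>\<^sub>2 \<eta>\<^sub>1 c\<^sub>f c\<^sub>g c\<^sub>h c\<^sub>b L c\<^sub>a c\<^sub>\<alpha> c\<^sub>e \<nu> :: real
  assumes "prob_space M"
    and "\<Theta> > 0" "\<delta>\<^sub>m\<^sub>a\<^sub>x > 0" "\<delta>\<^sub>0 \<in> {0<..<\<delta>\<^sub>m\<^sub>a\<^sub>x}" "\<gamma>\<^sub>1 \<in> {0<..<1}" "\<eta>\<^sub>1 \<in> {0<..<1}" "\<gamma>\<^sub>2 = 1 / \<gamma>\<^sub>1"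
    and "smop_process M \<Theta> \<delta>\<^sub>m\<^sub>a\<^sub>x \<gamma>\<^sub>1 \<gamma>\<^sub>2 \<eta>\<^sub>1 x\<^sub>0 \<delta>\<^sub>0 Ft G H D X \<Delta>"
    and "\<And>i. twice_cont_diff (f i)" "\<And>i. bdd_below (range (f i))"
    and "c\<^sub>h > 0" "c\<^sub>b > 0"
    and "\<And>i x. mat_norm (hessian (f i) x) \<le> c\<^sub>h"
    and "\<And>k w. w \<in> space M \<Longrightarrow> model_beta (\<lambda>i. H k i w) \<le> c\<^sub>b"
    and "L > 0" "c\<^sub>a > 0"
    and "\<And>k i w. w \<in> space M \<Longrightarrow> cont_diff (Ft k i w)"
    and "\<And>k i w. w \<in> space M \<Longrightarrow> L-lipschitz_on UNIV (grad (Ft k i w))"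
    and "\<And>k i w. w \<in> space M \<Longrightarrow> norm (grad (Ft k i w) (X k w) - G k i w) \<le> c\<^sub>a * \<Delta> k w"
    and "c\<^sub>f > 0" "c\<^sub>g > 0" "\<And>k. \<alpha> k \<in> {0..1}"
    and "jipfl M c\<^sub>f c\<^sub>g \<alpha> f X \<Delta> (\<lambda>k i w. quad_model (Ft k i w (X k w)) (G k i w) (H k i w))"
    and "\<exists>C. \<forall>k. \<forall>w\<in>space M. norm (X k w) \<le> C"
    and "summable (\<lambda>k. 1 - \<alpha> k ^ CARD('q))" "(\<Sum>k. 1 - \<alpha> k ^ CARD('q)) \<le> c\<^sub>\<alpha>"
    and "c\<^sub>e = c\<^sub>f + L + c\<^sub>g + c\<^sub>a + c\<^sub>h / 2"
    and "\<nu> \<in> {0<..<1}"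
    and "\<Theta> \<ge> Max {c\<^sub>b, 5 * c\<^sub>f, 4 * c\<^sub>e / \<eta>\<^sub>1}"
    and "\<nu> / (1 - \<nu>) \<ge> (4 * \<gamma>\<^sub>2\<^sup>2 - 2) / min c\<^sub>e c\<^sub>f"
  shows "AE w in M. (\<lambda>k. marginal f (X k w)) \<longlonglongrightarrow> 0"
proof -
  interpret prob_space M by fact
  note process = assms(8)[unfolded smop_process_def]
  have \<Theta>: "c\<^sub>b \<le> \<Theta>" "5 * c\<^sub>f \<le> \<Theta>" using assms(29) by simp_all
  \<comment> \<open>Positivity is needed at every index, since the tail may start at any
    iteration.\<close>
  have pos: "\<Delta> k w > 0" if "w \<in> space M" for k w
  proof (induction k)
    case 0
    then show ?case using process assms(4) that by simp
  next
    case (Suc k)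
    have "smop_iteration \<Theta> \<delta>\<^sub>m\<^sub>a\<^sub>x \<gamma>\<^sub>1 \<gamma>\<^sub>2 \<eta>\<^sub>1 (\<lambda>i. Ft k i w) (\<lambda>i. G k i w) (\<lambda>i. H k i w)
        (X k w) (\<Delta> k w) (D k w) (X (Suc k) w) (\<Delta> (Suc k) w)"
      using process that by blast
    then show ?case
      using Suc assms(3,5,7) by (auto simp: smop_iteration_def Let_def split: if_splits)
  qed
  have "AE w in M. \<forall>\<^sub>F k in sequentially. \<forall>i. fully_linear c\<^sub>f c\<^sub>g (f i) (X k w) (\<Delta> k w)
      (quad_model (Ft k i w (X k w)) (G k i w) (H k i w))"
    using process assms(22,23,25) by (intro jipfl_AE_eventually_fully_linear[where \<alpha> = \<alpha>]) auto
  then show ?thesis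
  proof (rule AE_mp, intro AE_I2 impI)
    fix w assume w: "w \<in> space M"
    assume "\<forall>\<^sub>F k in sequentially. \<forall>i. fully_linear c\<^sub>f c\<^sub>g (f i) (X k w) (\<Delta> k w)
      (quad_model (Ft k i w (X k w)) (G k i w) (H k i w))"
    then obtain K where K: "\<And>k i. k \<ge> K \<Longrightarrow> fully_linear c\<^sub>f c\<^sub>g (f i) (X k w) (\<Delta> k w)
      (quad_model (Ft k i w (X k w)) (G k i w) (H k i w))"
      by (auto simp: eventually_sequentially)
    \<comment> \<open>The algorithm restarted at iterate \<open>K\<close> obeys the same recursion,
      and shifting the index does not affect the limit.\<close>
    have "(\<lambda>k. marginal f (X (k + K) w)) \<longlonglongrightarrow> 0"
    proof (rule smop_path_marginal_tendsto_0[where \<eta>\<^sub>1 = \<eta>\<^sub>1 and c\<^sub>a = c\<^sub>a and c\<^sub>h = c\<^sub>h and L = L])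
      show "smop_iteration \<Theta> \<delta>\<^sub>m\<^sub>a\<^sub>x \<gamma>\<^sub>1 \<gamma>\<^sub>2 \<eta>\<^sub>1 (\<lambda>i. Ft (k + K) i w) (\<lambda>i. G (k + K) i w)
        (\<lambda>i. H (k + K) i w) (X (k + K) w) (\<Delta> (k + K) w) (D (k + K) w)
        (X (Suc k + K) w) (\<Delta> (Suc k + K) w)" for k
        using process w by simp
      show "fully_linear c\<^sub>f c\<^sub>g (f i) (X (k + K) w) (\<Delta> (k + K) w)
        (quad_model (Ft (k + K) i w (X (k + K) w)) (G (k + K) i w) (H (k + K) i w))" for k i
        by (rule K) simp
      show "model_beta (\<lambda>i. H (k + K) i w) \<le> \<Theta>" for k
        using assms(14)[OF w] \<Theta>(1) by (rule order_trans)
      show "\<gamma>\<^sub>2 \<ge> 1" using assms(5,7) by simp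
    qed (use assms \<Theta> pos w in auto)
    then show "(\<lambda>k. marginal f (X k w)) \<longlonglongrightarrow> 0" by (rule LIMSEQ_offset)
  qed
qed

end
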